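(* There are only finitely many combinatorial types of ternary perfect Hermitian forms over imaginary quadratic fields. That is, as $F$ ranges over all imaginary quadratic fields and $A$ ranges over all ternary perfect Hermitian forms over $F$, the associated polytopes $P_A$ fall into only finitely many combinatorial equivalence classes.
   Context: Let $F=\mathbb{Q}(\sqrt{-d})$ with $d$ a squarefree positive integer, let $\mathcal{O}_F$ be its ring of integers, and fix a complex embedding $F\hookrightarrow\mathbb{C}$, identifying $F$ with its image. Let $\mathcal{H}^3(\mathbb{C})$ be the $9$-dimensional real vector space of $3\times 3$ complex Hermitian matrices, and let $C\subset\mathcal{H}^3(\mathbb{C})$ be the cone of positive definite matrices. Elements of $\mathcal{O}_F^3$ are regarded as column vectors, and for $v\in\mathcal{O}_F^3$ put $q(v)=vv^*\in\mathcal{H}^3(\mathbb{C})$, where $*$ denotes conjugate transpose. Each $A\in\mathcal{H}^3(\mathbb{C})$ defines a (ternary) Hermitian form over $F$ by $A[v]=v^*Av=\operatorname{Tr}(A\,q(v))$ for $v\in\mathcal{O}_F^3$. For $A\in C$, let $\min(A)=\inf_{v\in\mathcal{O}_F^3\setminus\{0\}}A[v]$. A vector $v\in\mathcal{O}_F^3$ is a minimal vector of $A$ if $A[v]=\min(A)$, and $\operatorname{Min}(A)$ is the set of minimal vectors, taken up to multiplication by units of $\mathcal{O}_F$ (note that $q(\lambda v)=q(v)$ for $\lambda\in\mathcal{O}_F^\times$). A form $A\in C$ is perfect over $F$ if $\operatorname{span}_{\mathbb{R}}\{q(v): v\in\operatorname{Min}(A)\}=\mathcal{H}^3(\mathbb{C})$.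 Perfect forms are normalized so that $\min(A)=1$; positive scaling does not change $\operatorname{Min}(A)$. The polytope associated to a perfect form $A$ is the convex hull $P_A=\operatorname{conv}\{q(v): v\in\operatorname{Min}(A)\}\subset\mathcal{H}^3(\mathbb{C})$. Two polytopes $P,P'$ are combinatorially equivalent if there is a bijection between their sets of faces that preserves inclusion in both directions (an isomorphism of face lattices). Two perfect forms (possibly over different fields) have the same combinatorial type if their associated polytopes are combinatorially equivalent. *)

theory Defs
  imports
    "HOL-Analysis.Analysis"
    "HOL-Computational_Algebra.Polynomial"
    "HOL-Computational_Algebra.Squarefree"
begin

(* The field and its ring of integers are given by their images in the complex numbers;
   both complex embeddings of the field have the same image. *)

definition imag_quad_field :: "nat \<Rightarrow> complex set" where
  "imag_quad_field d = {of_rat a + of_rat b * csqrt (- of_nat d) | a b. True}"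

definition imag_quad_integers :: "nat \<Rightarrow> complex set" where
  "imag_quad_integers d = {z \<in> imag_quad_field d. algebraic_int z}"

definition integral_vectors :: "nat \<Rightarrow> (complex ^ 3) set" where
  "integral_vectors d = {v. \<forall>i. v $ i \<in> imag_quad_integers d}"

definition conj_transpose :: "complex ^ 'n ^ 'm \<Rightarrow> complex ^ 'm ^ 'n" where
  "conj_transpose A = (\<chi> i j. cnj (A $ j $ i))"

definition hermitian_matrices :: "(complex ^ 3 ^ 3) set" where
  "hermitian_matrices = {A. conj_transpose A = A}"

definition rank_one :: "complex ^ 3 \<Rightarrow> complex ^ 3 ^ 3" where
  "rank_one v = (\<chi> i j. v $ i * cnj (v $ j))"

(* The value v* A v; for Hermitian A it is already real, so that taking the real part only
   serves to obtain a term of type real. *)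
definition form_value :: "complex ^ 3 ^ 3 \<Rightarrow> complex ^ 3 \<Rightarrow> real" where
  "form_value A v = Re (\<Sum>i\<in>UNIV. cnj (v $ i) * (A *v v) $ i)"

lemma of_real_form_value:
  assumes "A \<in> hermitian_matrices"
  shows "complex_of_real (form_value A v) = (\<Sum>i\<in>UNIV. cnj (v $ i) * (A *v v) $ i)"
proof -
  have A: "cnj (A $ i $ j) = A $ j $ i" for i j
    using assms unfolding hermitian_matrices_def conj_transpose_def
    by (metis (mono_tags, lifting) mem_Collect_eq vec_lambda_beta)
  let ?s = "\<Sum>i\<in>UNIV. cnj (v $ i) * (A *v v) $ i"
  have s: "?s = (\<Sum>i\<in>UNIV. \<Sum>j\<in>UNIV. cnj (v $ i) * A $ i $ j * v $ j)"
    by (simp add: matrix_vector_mult_def sum_distrib_left mult.assoc)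
  have "cnj ?s = (\<Sum>i\<in>UNIV. \<Sum>j\<in>UNIV. v $ i * A $ j $ i * cnj (v $ j))"
    by (simp add: s A)
  also have "\<dots> = (\<Sum>j\<in>UNIV. \<Sum>i\<in>UNIV. v $ i * A $ j $ i * cnj (v $ j))"
    by (rule sum.swap)
  also have "\<dots> = ?s"
    by (simp add: s mult_ac)
  finally have "?s \<in> \<real>"
    by (simp add: Reals_cnj_iff)
  then show ?thesis
    unfolding form_value_def by (rule of_real_Re)
qed

lemma form_value_eq_trace:
  "form_value A v = Re (trace (A ** rank_one v))"
  by (simp add: form_value_def rank_one_def trace_def matrix_matrix_mult_def
      matrix_vector_mult_def sum_distrib_left sum_distrib_right mult_ac)

definition positive_definite_forms :: "(complex ^ 3 ^ 3) set" where
  "positive_definite_forms = {A \<in> hermitian_matrices. \<forall>v. v \<noteq> 0 \<longrightarrow> form_value A v > 0}"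

definition form_min :: "nat \<Rightarrow> complex ^ 3 ^ 3 \<Rightarrow> real" where
  "form_min d A = (INF v \<in> integral_vectors d - {0}. form_value A v)"

(* All minimal vectors are kept, not one per orbit under multiplication by units: units of an
   imaginary quadratic field have absolute value 1, so by rank_one_scale below the image of this
   set under rank_one is the same. *)
definition minimal_vectors :: "nat \<Rightarrow> complex ^ 3 ^ 3 \<Rightarrow> (complex ^ 3) set" where
  "minimal_vectors d A = {v \<in> integral_vectors d. form_value A v = form_min d A}"

lemma rank_one_scale:
  assumes "norm u = 1"
  shows "rank_one (u *s v) = rank_one v"
proof -
  have "u * cnj u = 1"
    using assms by (simp add: complex_norm_square [symmetric])
  then have "(u * x) * cnj (u * y) = x * cnj y" for x y
    by (metis complex_cnj_mult mult.left_neutral mult.assoc mult.commute)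
  then show ?thesis
    by (simp add: rank_one_def vec_eq_iff)
qed

(* The span is taken over the reals; no normalisation of the minimum is imposed. *)
definition perfect_form :: "nat \<Rightarrow> complex ^ 3 ^ 3 \<Rightarrow> bool" where
  "perfect_form d A \<longleftrightarrow>
     A \<in> positive_definite_forms \<and> span (rank_one ` minimal_vectors d A) = hermitian_matrices"

definition form_polytope :: "nat \<Rightarrow> complex ^ 3 ^ 3 \<Rightarrow> (complex ^ 3 ^ 3) set" where
  "form_polytope d A = convex hull (rank_one ` minimal_vectors d A)"

definition combinatorially_equivalent ::
    "'a::real_vector set \<Rightarrow> 'b::real_vector set \<Rightarrow> bool" where
  "combinatorially_equivalent P Q \<longleftrightarrow>
     (\<exists>f. bij_betw f {F. F face_of P} {G. G face_of Q} \<and>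
          (\<forall>F F'. F face_of P \<longrightarrow> F' face_of P \<longrightarrow> (F \<subseteq> F' \<longleftrightarrow> f F \<subseteq> f F')))"

lemma equiv_combinatorially_equivalent:
  "equiv UNIV {(P, Q :: 'a::real_vector set). combinatorially_equivalent P Q}"
proof (rule equivI)
  show "{(P, Q :: 'a set). combinatorially_equivalent P Q} \<subseteq> UNIV \<times> UNIV"
    by simp
  show "refl {(P, Q :: 'a set). combinatorially_equivalent P Q}"
    unfolding refl_on_def combinatorially_equivalent_def
    by (auto intro!: exI [of _ id])
  show "sym {(P, Q :: 'a set). combinatorially_equivalent P Q}"
  proof (rule symI, clarify)
    fix P Q :: "'a set"
    assume "combinatorially_equivalent P Q"
    then obtain f where f: "bij_betw f {F. F face_of P} {G. G face_of Q}"
      and m: "\<And>F F'. F face_of P \<Longrightarrow> F' face_of P \<Longrightarrow> F \<subseteq> F' \<longleftrightarrow> f F \<subseteq> f F'"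
      unfolding combinatorially_equivalent_def by blast
    let ?g = "inv_into {F. F face_of P} f"
    have g: "bij_betw ?g {G. G face_of Q} {F. F face_of P}"
      using f by (rule bij_betw_inv_into)
    have "?g G face_of P \<and> f (?g G) = G" if "G face_of Q" for G
      using g bij_betw_inv_into_right [OF f, of G] that by (auto dest: bij_betwE)
    then show "combinatorially_equivalent Q P"
      unfolding combinatorially_equivalent_def using g m by (intro exI [of _ ?g]) metis
  qed
  show "trans {(P, Q :: 'a set). combinatorially_equivalent P Q}"
  proof (rule transI, clarify)
    fix P Q R :: "'a set"
    assume "combinatorially_equivalent P Q" "combinatorially_equivalent Q R"
    then obtain f g where f: "bij_betw f {F. F face_of P} {G. G face_of Q}"
      and m: "\<And>F F'. F face_of P \<Longrightarrow> F' face_of P \<Longrightarrow> F \<subseteq> F' \<longleftrightarrow> f F \<subseteq> f F'"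
      and g: "bij_betw g {F. F face_of Q} {G. G face_of R}"
      and n: "\<And>F F'. F face_of Q \<Longrightarrow> F' face_of Q \<Longrightarrow> F \<subseteq> F' \<longleftrightarrow> g F \<subseteq> g F'"
      unfolding combinatorially_equivalent_def by metis
    have "f F face_of Q" if "F face_of P" for F
      using f that by (auto dest: bij_betwE)
    with m n have "\<forall>F F'. F face_of P \<longrightarrow> F' face_of P \<longrightarrow> (F \<subseteq> F' \<longleftrightarrow> (g \<circ> f) F \<subseteq> (g \<circ> f) F')"
      by simp
    with bij_betw_trans [OF f g] show "combinatorially_equivalent P R"
      unfolding combinatorially_equivalent_def by blast
  qed
qed

end

theory Submission
  imports Defs
begin

text \<open>
  The lattice of integral vectors has rank 6 over the integers. If two minimal vectors v and w are
  congruent modulo 2, then u = (v - w)/2 and p = (v + w)/2 are integral, and the parallelogram law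
  A[v] + A[w] = 2 A[p] + 2 A[u] forces u = 0 or p = 0, that is v = w or v = -w. So the number of
  vertices of the polytope is bounded independently of the field, and a polytope with a bounded
  number of vertices has only finitely many possible face lattices.
\<close>

section \<open>Algebraic integers of degree two\<close>

lemma poly_map_of_int_mult:
  fixes x :: "'a::comm_ring_1"
  shows "poly (map_poly of_int (p * q)) x = poly (map_poly of_int p) x * poly (map_poly of_int q) x"
proof -
  have "map_poly of_int (p * q) = (map_poly of_int p * map_poly of_int q :: 'a poly)"
    by (rule poly_eqI) (simp add: coeff_map_poly coeff_mult)
  then show ?thesis by simp
qed

lemma poly_map_of_int_add:
  fixes x :: "'a::comm_ring_1"
  shows "poly (map_poly of_int (p + q)) x = poly (map_poly of_int p) x + poly (map_poly of_int q) x"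
proof -
  have "map_poly of_int (p + q) = (map_poly of_int p + map_poly of_int q :: 'a poly)"
    by (rule poly_eqI) (simp add: coeff_map_poly)
  then show ?thesis by simp
qed

lemma poly_map_of_int_smult:
  fixes x :: "'a::comm_ring_1"
  shows "poly (map_poly of_int (smult c q)) x = of_int c * poly (map_poly of_int q) x"
proof -
  have "map_poly of_int (smult c q) = (smult (of_int c) (map_poly of_int q) :: 'a poly)"
    by (rule poly_eqI) (simp add: coeff_map_poly)
  then show ?thesis by simp
qed

text \<open>This is Gauss's lemma at work: a primitive \<open>q\<close> of least degree with root
  \<open>x\<close> divides a monic integer polynomial with root \<open>x\<close> already over the
  integers, so its leading coefficient divides 1.\<close>

lemma algebraic_int_primitive_minimal_poly:
  fixes x :: "'a::field_char_0" and q :: "int poly"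
  assumes x: "algebraic_int x" and q: "content q = 1" and root: "poly (map_poly of_int q) x = 0"
    and minimal: "\<And>r :: int poly. r \<noteq> 0 \<Longrightarrow> degree r < degree q \<Longrightarrow> poly (map_poly of_int r) x \<noteq> 0"
  shows "is_unit (lead_coeff q)"
proof -
  obtain p :: "int poly" where p: "poly (map_poly of_int p) x = 0" "lead_coeff p = 1"
    using x by (auto simp: algebraic_int_altdef_ipoly)
  have q0: "q \<noteq> 0" using q by auto
  obtain s r where sr: "pseudo_divmod p q = (s, r)" by fastforce
  \<comment> \<open>Pseudo-division scales \<open>p\<close> by this power of the leading coefficient
    of \<open>q\<close> to keep quotient and remainder integral; \<open>c\<close> has to be
    cancelled afterwards.\<close>
  define c where "c = lead_coeff q ^ (Suc (degree p) - degree q)"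
  have c: "c \<noteq> 0" using q0 by (simp add: c_def)
  have eq: "smult c p = q * s + r" and r: "r = 0 \<or> degree r < degree q"
    using pseudo_divmod[OF q0 sr] by (auto simp: c_def)
  have "poly (map_poly of_int r) x = 0"
    using arg_cong[OF eq, of "\<lambda>f. poly (map_poly of_int f) x"] p(1) root
    by (simp add: poly_map_of_int_mult poly_map_of_int_add poly_map_of_int_smult)
  then have "r = 0" using r minimal by blast
  then have eq: "smult c p = q * s" using eq by simp
  have "content p dvd 1" using content_dvd_coeff[of p "degree p"] p(2) by simp
  then have "content p = 1" by (simp only: is_unit_content_iff)
  \<comment> \<open>Contents are multiplicative and both \<open>p\<close> and \<open>q\<close> are
    primitive, so all of \<open>c\<close> sits in \<open>s\<close>.\<close>
  then have "content s = normalize c"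
    using arg_cong[OF eq, of content] q by (simp add: content_mult)
  then have "[:c:] dvd s" by (simp add: const_poly_dvd_iff_dvd_content)
  then obtain s' where "s = smult c s'" by (auto elim!: dvdE)
  then have "smult c p = smult c (q * s')" using eq by simp
  then have "p = q * s'" using c by (metis smult_cancel)
  then show ?thesis using p(2) by (metis dvd_triv_left lead_coeff_mult)
qed

text \<open>An irrational \<open>x\<close> is a root of no nonzero integer polynomial of degree at
  most 1, so the primitive integer multiple of X^2 - t X + n has least degree. Its leading
  coefficient is then a unit, which leaves no denominators in \<open>t\<close> and
  \<open>n\<close>.\<close>

lemma algebraic_int_quadratic_coeffs:
  fixes x :: "'a::field_char_0" and t n :: rat
  assumes x: "algebraic_int x" and irr: "x \<notin> \<rat>"
    and root: "x\<^sup>2 - of_rat t * x + of_rat n = 0"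
  shows "t \<in> \<int>" "n \<in> \<int>"
proof -
  obtain t1 t2 where t: "t = of_int t1 / of_int t2" "t2 > 0"
    by (metis quotient_of_div quotient_of_denom_pos quotient_of_coprime surj_pair)
  obtain n1 n2 where n: "n = of_int n1 / of_int n2" "n2 > 0"
    by (metis quotient_of_div quotient_of_denom_pos quotient_of_coprime surj_pair)
  define D where "D = t2 * n2"
  \<comment> \<open>X^2 - t X + n times the common denominator \<open>D\<close>, coefficients listed
    from the constant term upwards.\<close>
  define f where "f = [:n1 * t2, - t1 * n2, D:]"
  define q where "q = primitive_part f"
  have D: "D > 0" using t n by (simp add: D_def)
  have deg: "degree f = 2" and lead: "lead_coeff f = D" using D by (auto simp: f_def)
  have f0: "f \<noteq> 0" using deg by auto
  have f: "f = smult (content f) q" by (simp add: q_def)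
  have tx: "(of_rat t :: 'a) = of_int t1 / of_int t2" and nx: "(of_rat n :: 'a) = of_int n1 / of_int n2"
    by (simp_all add: t n of_rat_divide)
  have "poly (map_poly of_int f) x = of_int D * (x\<^sup>2 - of_rat t * x + of_rat n)"
    using t n D by (simp add: f_def map_poly_pCons D_def tx nx field_simps power2_eq_square)
  then have "poly (map_poly of_int f) x = 0" using root by simp
  then have rootq: "poly (map_poly of_int q) x = 0"
    using f0 by (subst (asm) f) (simp add: poly_map_of_int_smult)
  have "is_unit (lead_coeff q)"
  proof (rule algebraic_int_primitive_minimal_poly[OF x _ rootq])
    show "content q = 1" using f0 by (simp add: q_def)
    fix r :: "int poly" assume r: "r \<noteq> 0" "degree r < degree q"
    then have "degree r \<le> 1" using deg by (simp add: q_def)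
    then obtain a b where ab: "r = [:a, b:]"
      using pCons_cases[of r] degree_eq_zeroE
      by (metis degree_pCons_eq_if le_zero_eq not_less_eq_eq One_nat_def pCons_0_0)
    show "poly (map_poly of_int r) x \<noteq> 0"
    proof
      assume "poly (map_poly of_int r) x = 0"
      then have h: "of_int a + x * of_int b = 0" by (simp add: ab map_poly_pCons)
      then have "b \<noteq> 0" using r ab by auto
      with h have "x = - of_int a / of_int b" by (simp add: field_simps eq_neg_iff_add_eq_0)
      then show False using irr by simp
    qed
  qed
  \<comment> \<open>The second factor is a unit, so \<open>D\<close> divides the content and hence
    every coefficient of \<open>f\<close>; cancelling \<open>t2\<close> or \<open>n2\<close> then
    gives the two divisibilities.\<close>
  moreover have "D = content f * lead_coeff q" using lead f by (metis lead_coeff_smult)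
  ultimately have "D dvd content f" by (metis dvd_refl mult_unit_dvd_iff)
  then have "D dvd coeff f i" for i using content_dvd_coeff dvd_trans by blast
  from this[of 0] this[of 1] have "D dvd n1 * t2" "D dvd t1 * n2" by (auto simp: f_def)
  then have "n2 dvd n1" "t2 dvd t1" using t n by (auto simp: D_def mult.commute)
  then show "t \<in> \<int>" "n \<in> \<int>" using t n by (auto elim!: dvdE)
qed

section \<open>Ring of integers of an imaginary quadratic field\<close>

lemma squarefree_mult_square_in_Ints:
  fixes r :: rat
  assumes "squarefree d" "of_nat d * r\<^sup>2 \<in> \<int>"
  shows "r \<in> \<int>"
proof -
  obtain p q where r: "r = of_int p / of_int q" "q > 0" "coprime p q"
    by (metis quotient_of_div quotient_of_denom_pos quotient_of_coprime surj_pair)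
  obtain k where "of_nat d * r\<^sup>2 = of_int k" using assms(2) by (auto elim: Ints_cases)
  then have "(of_int (int d * p\<^sup>2) :: rat) = of_int (k * q\<^sup>2)"
    using r by (simp add: field_simps power2_eq_square)
  then have "int d * p\<^sup>2 = k * q\<^sup>2" by (simp only: of_int_eq_iff)
  then have "q\<^sup>2 dvd int d * p\<^sup>2" by simp
  \<comment> \<open>The fraction is reduced, so the square of its denominator falls on the
    squarefree \<open>d\<close>.\<close>
  then have "q\<^sup>2 dvd int d" using r(3)
    by (simp add: coprime_dvd_mult_left_iff coprime_commute)
  then have "(nat q)\<^sup>2 dvd d" using r(2)
    by (metis int_dvd_int_iff less_imp_le nat_0_le of_nat_power)
  then have "nat q = 1" using squarefreeD[OF assms(1)] by auto
  then have "q = 1" using r(2) by simp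
  then show ?thesis using r(1) by simp
qed

text \<open>Here \<open>m\<close> is the trace and (m^2 + d n^2) / 4 the norm, and integrality means
  that both are integers. The single divisibility condition covers all residues of \<open>d\<close>
  modulo 4 without the usual case split.\<close>

lemma imag_quad_integers_eq:
  assumes d: "d > 0" "squarefree d"
  shows "imag_quad_integers d =
    {(of_int m + of_int n * csqrt (- of_nat d)) / 2 | m n. 4 dvd m\<^sup>2 + int d * n\<^sup>2}"
    (is "_ = ?R")
proof
  define s where "s = csqrt (- of_nat d)"
  have s2: "s * s = - of_nat d"
    by (metis power2_csqrt power2_eq_square s_def)
  have irr: "s \<notin> \<rat>"
  proof
    assume "s \<in> \<rat>"
    then obtain p q where "s = of_int p / of_int q" by (elim Rats_cases')
    then have "s = of_real (of_int p / of_int q)" by simp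
    then have "Im s = 0" by (metis Im_complex_of_real)
    then show False using d by (simp add: s_def)
  qed
  show "imag_quad_integers d \<subseteq> ?R"
  proof
    fix x assume "x \<in> imag_quad_integers d"
    then obtain a b where x: "x = of_rat a + of_rat b * s" and int: "algebraic_int x"
      by (auto simp: imag_quad_integers_def imag_quad_field_def s_def)
    \<comment> \<open>These are trace and norm. A rational \<open>x\<close> has a minimal polynomial
      of degree 1 and is treated apart: there \<open>b = 0\<close> and \<open>a\<close> is an
      integer.\<close>
    have "2 * a \<in> \<int> \<and> a\<^sup>2 + of_nat d * b\<^sup>2 \<in> \<int>"
    proof (cases "x \<in> \<rat>")
      case True
      have "b = 0"
      proof (rule ccontr)
        assume "b \<noteq> 0"
        then have "s = (x - of_rat a) / of_rat b" by (simp add: x)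
        then show False using True irr by simp
      qed
      have "x \<in> \<int>" using rational_algebraic_int_is_int int True by blast
      then obtain k where "x = of_int k" by (elim Ints_cases)
      then have "of_rat a = (of_rat (of_int k) :: complex)" using x \<open>b = 0\<close> by simp
      then have "a = of_int k" by (simp only: of_rat_eq_iff)
      then show ?thesis using \<open>b = 0\<close> by auto
    next
      case False
      have "x\<^sup>2 - of_rat (2 * a) * x + of_rat (a\<^sup>2 + of_nat d * b\<^sup>2) = of_rat (b\<^sup>2) * (s * s + of_nat d)"
        by (simp add: x of_rat_add of_rat_mult of_rat_power algebra_simps power2_eq_square)
      also have "\<dots> = 0" by (simp add: s2)
      finally show ?thesis using algebraic_int_quadratic_coeffs[OF int False] by blast
    qed
    then have a: "2 * a \<in> \<int>" and N: "a\<^sup>2 + of_nat d * b\<^sup>2 \<in> \<int>" by auto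
    \<comment> \<open>Four times the norm minus the squared trace is d (2b)^2, so squarefreeness of
      \<open>d\<close> makes \<open>2 * b\<close> an integer.\<close>
    have "4 * (a\<^sup>2 + of_nat d * b\<^sup>2) - (2 * a)\<^sup>2 \<in> \<int>"
      by (intro Ints_diff Ints_mult Ints_power a N) simp
    then have "of_nat d * (2 * b)\<^sup>2 \<in> \<int>" by (simp add: power2_eq_square algebra_simps)
    then have "2 * b \<in> \<int>" using squarefree_mult_square_in_Ints d by blast
    with a obtain m n where mn: "2 * a = of_int m" "2 * b = of_int n" by (auto elim!: Ints_cases)
    obtain k where k: "a\<^sup>2 + of_nat d * b\<^sup>2 = of_int k" using N by (auto elim: Ints_cases)
    have "of_int (m\<^sup>2 + int d * n\<^sup>2) = (2 * a)\<^sup>2 + of_nat d * (2 * b)\<^sup>2" by (simp add: mn)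
    also have "\<dots> = of_int (4 * k)" using k by (simp add: power2_eq_square algebra_simps)
    finally have "m\<^sup>2 + int d * n\<^sup>2 = 4 * k" by (simp only: of_int_eq_iff)
    moreover have "x = (of_int m + of_int n * s) / 2"
    proof -
      have "a = of_int m / 2" "b = of_int n / 2" using mn by auto
      then have "of_rat a = (of_int m / 2 :: complex)" "of_rat b = (of_int n / 2 :: complex)"
        by (simp_all only: of_rat_divide of_rat_of_int_eq of_rat_numeral_eq)
      then show ?thesis unfolding x by (simp only:) (simp add: add_divide_distrib)
    qed
    ultimately show "x \<in> ?R" unfolding s_def by (metis (mono_tags, lifting) dvd_triv_left mem_Collect_eq)
  qed
  show "?R \<subseteq> imag_quad_integers d"
  proof
    fix x assume "x \<in> ?R"
    then obtain m n k where x: "x = (of_int m + of_int n * s) / 2" and k: "m\<^sup>2 + int d * n\<^sup>2 = 4 * k"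
      unfolding s_def[symmetric] by (auto elim!: dvdE)
    have "x = of_rat (of_int m / 2) + of_rat (of_int n / 2) * s"
      by (simp add: x of_rat_divide field_simps)
    then have "x \<in> imag_quad_field d" unfolding imag_quad_field_def s_def by blast
    \<comment> \<open>The monic polynomial is X^2 - m X + k, where \<open>k\<close> is the
      norm.\<close>
    moreover have "algebraic_int x"
    proof (rule algebraic_int.intros)
      have "(of_int (m\<^sup>2 + int d * n\<^sup>2) :: complex) = of_int (4 * k)" using k by simp
      then have k': "of_nat d * (of_int n)\<^sup>2 = 4 * of_int k - (of_int m :: complex)\<^sup>2"
        by (simp add: algebra_simps)
      show "lead_coeff [:of_int k, - of_int m, 1 :: complex:] = 1" by simp
      show "\<forall>i. coeff [:of_int k, - of_int m, 1 :: complex:] i \<in> \<int>"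
        by (auto simp: coeff_pCons split: nat.splits)
      have "4 * poly [:of_int k, - of_int m, 1:] x
          = 4 * of_int k - (of_int m)\<^sup>2 + (of_int n)\<^sup>2 * (s * s)"
        by (simp add: x field_simps power2_eq_square)
      also have "\<dots> = 0" using k' by (simp add: s2 mult.commute)
      finally show "poly [:of_int k, - of_int m, 1:] x = 0" by (simp only: mult_eq_0_iff) simp
    qed
    ultimately show "x \<in> imag_quad_integers d" by (simp add: imag_quad_integers_def)
  qed
qed

text \<open>Coordinates modulo 4 appear because the coordinates of an integer are half-integers.\<close>

lemma imag_quad_integers_half:
  assumes d: "d > 0" "squarefree d"
  obtains c :: "complex \<Rightarrow> int \<times> int"
    where "range c \<subseteq> {0..<4} \<times> {0..<4}"
      and "\<And>x y. x \<in> imag_quad_integers d \<Longrightarrow> y \<in> imag_quad_integers d \<Longrightarrow> c x = c y \<Longrightarrow>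
        (x - y) / 2 \<in> imag_quad_integers d \<and> (x + y) / 2 \<in> imag_quad_integers d"
proof -
  define s where "s = csqrt (- of_nat d)"
  have O: "imag_quad_integers d =
      {(of_int m + of_int n * s) / 2 | m n. 4 dvd m\<^sup>2 + int d * n\<^sup>2}"
    using imag_quad_integers_eq[OF d] by (simp add: s_def)
  \<comment> \<open>The implication under the quantifiers makes \<open>g\<close> total. Its
    arbitrary values outside the ring do no harm, since reduction modulo 4 bounds the range of
    \<open>c\<close> everywhere.\<close>
  have "\<forall>x. \<exists>mn. x \<in> imag_quad_integers d \<longrightarrow>
      x = (of_int (fst mn) + of_int (snd mn) * s) / 2 \<and> 4 dvd (fst mn)\<^sup>2 + int d * (snd mn)\<^sup>2"
    unfolding O by auto
  then obtain g where g: "\<And>x. x \<in> imag_quad_integers d \<Longrightarrow>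
      x = (of_int (fst (g x)) + of_int (snd (g x)) * s) / 2 \<and>
      4 dvd (fst (g x))\<^sup>2 + int d * (snd (g x))\<^sup>2"
    by metis
  define c where "c x = (fst (g x) mod 4, snd (g x) mod 4)" for x
  have "(x - y) / 2 \<in> imag_quad_integers d \<and> (x + y) / 2 \<in> imag_quad_integers d"
    if x: "x \<in> imag_quad_integers d" and y: "y \<in> imag_quad_integers d" and xy: "c x = c y" for x y
  proof -
    define m where "m = fst (g y)"
    define n where "n = snd (g y)"
    have "4 dvd fst (g x) - m" "4 dvd snd (g x) - n"
      using xy by (auto simp: c_def m_def n_def mod_eq_dvd_iff)
    then obtain k l where k: "fst (g x) = m + 4 * k" and l: "snd (g x) = n + 4 * l"
      by (metis add.commute diff_add_cancel dvdE)
    have X: "x = (of_int (m + 4 * k) + of_int (n + 4 * l) * s) / 2" using g[OF x] k l by simp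
    have Y: "y = (of_int m + of_int n * s) / 2" and N: "4 dvd m\<^sup>2 + int d * n\<^sup>2"
      using g[OF y] by (auto simp: m_def n_def)
    \<comment> \<open>The halved difference is k + l s, and the halved sum is \<open>y\<close> plus
      this element.\<close>
    have "(x - y) / 2 = (of_int (2 * k) + of_int (2 * l) * s) / 2"
      by (simp add: X Y field_simps)
    moreover have "4 dvd (2 * k)\<^sup>2 + int d * (2 * l)\<^sup>2"
      by (simp add: power_mult_distrib)
    moreover have "(x + y) / 2 = (of_int (m + 2 * k) + of_int (n + 2 * l) * s) / 2"
      by (simp add: X Y field_simps)
    moreover have "4 dvd (m + 2 * k)\<^sup>2 + int d * (n + 2 * l)\<^sup>2"
    proof -
      have "(m + 2 * k)\<^sup>2 + int d * (n + 2 * l)\<^sup>2 =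
          (m\<^sup>2 + int d * n\<^sup>2) + 4 * (m * k + k\<^sup>2 + int d * (n * l + l\<^sup>2))"
        by (simp add: power2_eq_square algebra_simps)
      then show ?thesis using N by (metis dvd_add dvd_triv_left)
    qed
    ultimately show ?thesis unfolding O by blast
  qed
  then show thesis by (intro that[of c]) (auto simp: c_def)
qed

section \<open>Minimal vectors modulo 2\<close>

lemma form_value_parallelogram:
  "form_value A (p + u) + form_value A (p - u) = 2 * form_value A p + 2 * form_value A u"
  unfolding form_value_def matrix_vector_right_distrib matrix_vector_mult_diff_distrib Re_sum
    sum_distrib_left sum.distrib[symmetric]
  by (rule sum.cong) (simp_all add: algebra_simps)

lemma minimal_vectors_congruent:
  assumes A: "A \<in> positive_definite_forms"
    and v: "v \<in> minimal_vectors d A" and w: "w \<in> minimal_vectors d A"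
    and u: "u \<in> integral_vectors d" and p: "p \<in> integral_vectors d"
    and vw: "v = p + u" "w = p - u"
  shows "u = 0 \<or> p = 0"
proof (rule ccontr)
  assume neg: "\<not> ?thesis"
  have pos: "form_value A x > 0" if "x \<noteq> 0" for x
    using A that by (auto simp: positive_definite_forms_def)
  \<comment> \<open>A real infimum is a lower bound only if the set is bounded below; positivity
    supplies the bound 0.\<close>
  have bdd: "bdd_below (form_value A ` (integral_vectors d - {0}))"
    by (rule bdd_belowI[of _ 0]) (auto intro: less_imp_le pos)
  have "form_min d A \<le> form_value A u" "form_min d A \<le> form_value A p"
    unfolding form_min_def using u p neg by (auto intro!: cINF_lower[OF bdd])
  moreover have "form_value A v = form_min d A" "form_value A w = form_min d A"
    using v w by (auto simp: minimal_vectors_def)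
  \<comment> \<open>With M = \<open>form_min d A\<close> the law reads M = A[p] + A[u], while both
    summands are at least M. So the sum is at least twice itself, although it is positive.\<close>
  ultimately show False
    using form_value_parallelogram[of A p u, folded vw] pos[of u] pos[of p] neg by simp
qed

lemma rank_one_uminus: "rank_one (- v) = rank_one v"
  by (simp add: rank_one_def)

text \<open>A label consists of two residues modulo 4 for each of the three coordinates, which gives
  16^3 possible labels whatever \<open>d\<close> and \<open>A\<close> are. Equal labels make the
  halved sum and difference integral, so the vectors agree up to a sign, which
  \<open>rank_one\<close> forgets.\<close>

lemma inj_on_minimal_rank_one:
  assumes d: "d > 0" "squarefree d" and A: "A \<in> positive_definite_forms"
  shows "\<exists>h :: _ \<Rightarrow> 3 \<Rightarrow> int \<times> int. inj_on h (rank_one ` minimal_vectors d A) \<and>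
    h ` rank_one ` minimal_vectors d A \<subseteq> PiE UNIV (\<lambda>_. {0..<4} \<times> {0..<4})"
proof -
  obtain c :: "complex \<Rightarrow> int \<times> int"
    where range: "range c \<subseteq> {0..<4} \<times> {0..<4}"
      and c: "\<And>x y. x \<in> imag_quad_integers d \<Longrightarrow> y \<in> imag_quad_integers d \<Longrightarrow> c x = c y \<Longrightarrow>
        (x - y) / 2 \<in> imag_quad_integers d \<and> (x + y) / 2 \<in> imag_quad_integers d"
    using imag_quad_integers_half[OF d] by blast
  let ?M = "minimal_vectors d A"
  have same: "rank_one v = rank_one w"
    if v: "v \<in> ?M" and w: "w \<in> ?M" and eq: "\<And>i. c (v $ i) = c (w $ i)" for v w
  proof -
    define u where "u = (\<chi> i. (v $ i - w $ i) / 2)"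
    define p where "p = (\<chi> i. (v $ i + w $ i) / 2)"
    have "v = p + u" "w = p - u" by (auto simp: u_def p_def vec_eq_iff field_simps)
    moreover have "u \<in> integral_vectors d" "p \<in> integral_vectors d"
      using v w c[OF _ _ eq] by (auto simp: u_def p_def integral_vectors_def minimal_vectors_def)
    ultimately have "u = 0 \<or> p = 0" using minimal_vectors_congruent[OF A v w] by blast
    then show ?thesis
      using \<open>v = p + u\<close> \<open>w = p - u\<close> rank_one_uminus[of u] by auto
  qed
  \<comment> \<open>Several vectors yield the same matrix; fixing one makes the label depend on the
    matrix alone.\<close>
  define r where "r = inv_into ?M rank_one"
  have r: "r P \<in> ?M" "rank_one (r P) = P" if "P \<in> rank_one ` ?M" for P
    using that by (auto simp: r_def inv_into_into f_inv_into_f)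
  let ?h = "\<lambda>P i. c (r P $ i)"
  have "inj_on ?h (rank_one ` ?M)"
  proof (rule inj_onI)
    fix P Q assume P: "P \<in> rank_one ` ?M" and Q: "Q \<in> rank_one ` ?M" and "?h P = ?h Q"
    then have "rank_one (r P) = rank_one (r Q)" by (intro same r) (auto dest: fun_cong)
    then show "P = Q" using r(2) P Q by simp
  qed
  moreover have "?h ` rank_one ` ?M \<subseteq> PiE UNIV (\<lambda>_. {0..<4} \<times> {0..<4})"
    using range by (auto simp: PiE_UNIV_domain)
  ultimately show ?thesis by (intro exI[of _ ?h] conjI)
qed

section \<open>Face lattices of polytopes with boundedly many generators\<close>

text \<open>Labelling the generators by \<open>T\<close> turns each face lattice into a family of
  subsets of \<open>T\<close> ordered by inclusion, and only finitely many such families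
  exist.\<close>

lemma finite_combinatorial_types:
  fixes \<P> :: "'a::euclidean_space set set" and T :: "'b set"
  assumes T: "finite T"
    and P: "\<And>P. P \<in> \<P> \<Longrightarrow> \<exists>S h. P = convex hull S \<and> inj_on h S \<and> h ` S \<subseteq> T"
  shows "finite (\<P> // {(P, Q). combinatorially_equivalent P Q})"
proof -
  let ?R = "{(P, Q :: 'a set). combinatorially_equivalent P Q}"
  obtain S and h :: "'a set \<Rightarrow> 'a \<Rightarrow> 'b" where Sh:
    "\<And>P. P \<in> \<P> \<Longrightarrow> P = convex hull (S P) \<and> inj_on (h P) (S P) \<and> h P ` S P \<subseteq> T"
    using P by metis
  \<comment> \<open>A face is encoded by the labels of the generators it contains, so
    \<open>inv P\<close> is a copy of the face lattice within \<open>Pow T\<close>.\<close>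
  define e where "e P F = h P ` (S P \<inter> F)" for P F
  define inv where "inv P = e P ` {F. F face_of P}" for P
  have mono: "F \<subseteq> F' \<longleftrightarrow> e P F \<subseteq> e P F'"
    if "P \<in> \<P>" "F face_of P" "F' face_of P" for P F F'
  proof
    show "F \<subseteq> F' \<Longrightarrow> e P F \<subseteq> e P F'" by (auto simp: e_def)
    assume "e P F \<subseteq> e P F'"
    \<comment> \<open>Injectivity of \<open>h P\<close> on \<open>S P\<close> lets the labels be
      removed.\<close>
    then have sub: "S P \<inter> F \<subseteq> F'"
      using Sh[OF that(1)] inj_on_image_subset_iff[of "h P" "S P" "S P \<inter> F" "S P \<inter> F'"]
      by (auto simp: e_def)
    \<comment> \<open>A face of the hull of finitely many points is the hull of some of them, so it
      lies in every convex set containing its generators.\<close>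
    have "finite (S P)" using Sh[OF that(1)] T by (meson finite_imageD finite_subset)
    moreover have "F face_of convex hull (S P)" using Sh that by metis
    ultimately obtain S' where "S' \<subseteq> S P" "F = convex hull S'"
      using face_of_convex_hull_subset finite_imp_compact by metis
    then show "F \<subseteq> F'" using sub face_of_imp_convex[OF that(3)]
      by (metis IntI hull_inc hull_minimal in_mono subsetI)
  qed
  have bij: "bij_betw (e P) {F. F face_of P} (inv P)" if "P \<in> \<P>" for P
    unfolding inv_def by (rule inj_on_imp_bij_betw, rule inj_onI) (use mono[OF that] in blast)
  have equal: "?R `` {P} = ?R `` {Q}" if PQ: "P \<in> \<P>" "Q \<in> \<P>" "inv P = inv Q" for P Q
  proof (rule equiv_class_eq[OF equiv_combinatorially_equivalent])
    \<comment> \<open>Each face of \<open>P\<close> is matched with the face of \<open>Q\<close>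
      that has the same label set.\<close>
    define g where "g = inv_into {F. F face_of Q} (e Q)"
    have g: "bij_betw g (inv P) {F. F face_of Q}"
      unfolding g_def PQ(3) by (rule bij_betw_inv_into[OF bij[OF PQ(2)]])
    have gQ: "g X face_of Q" "e Q (g X) = X" if "X \<in> inv P" for X
      using that g bij_betw_inv_into_right[OF bij[OF PQ(2)], of X] PQ(3)
      by (auto simp: g_def dest: bij_betwE)
    have "F \<subseteq> F' \<longleftrightarrow> (g \<circ> e P) F \<subseteq> (g \<circ> e P) F'" if F: "F face_of P" "F' face_of P" for F F'
    proof -
      have X: "e P F \<in> inv P" "e P F' \<in> inv P" using F by (auto simp: inv_def)
      show ?thesis
        using mono[OF PQ(1) F] mono[OF PQ(2) gQ(1)[OF X(1)] gQ(1)[OF X(2)]] gQ(2) X by simp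
    qed
    then show "(P, Q) \<in> ?R"
      using bij_betw_trans[OF bij[OF PQ(1)] g] unfolding combinatorially_equivalent_def by blast
  qed
  have "inv ` \<P> \<subseteq> Pow (Pow T)" using Sh by (fastforce simp: inv_def e_def)
  then have "finite (inv ` \<P>)" using T by (meson finite_Pow_iff finite_subset)
  \<comment> \<open>One representative is chosen per invariant; by \<open>equal\<close> its class is
    that of every member with this invariant, so there are no more classes than invariants.\<close>
  moreover have "\<P> // ?R \<subseteq> (\<lambda>X. ?R `` {SOME P. P \<in> \<P> \<and> inv P = X}) ` inv ` \<P>"
  proof
    fix C assume "C \<in> \<P> // ?R"
    then obtain P where P: "P \<in> \<P>" "C = ?R `` {P}" by (auto simp: quotient_def)
    let ?Q = "SOME Q. Q \<in> \<P> \<and> inv Q = inv P"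
    have "?Q \<in> \<P> \<and> inv ?Q = inv P" by (rule someI[of _ P]) (simp add: P)
    then have "C = ?R `` {?Q}" using equal[of P ?Q] P by simp
    then show "C \<in> (\<lambda>X. ?R `` {SOME P. P \<in> \<P> \<and> inv P = X}) ` inv ` \<P>" using P(1) by blast
  qed
  ultimately show ?thesis by (meson finite_imageI finite_subset)
qed

theorem theorem2p9:
  shows "finite ({form_polytope d A | d A. d > 0 \<and> squarefree d \<and> perfect_form d A} //
                 {(P, Q). combinatorially_equivalent P Q})"
proof (rule finite_combinatorial_types)
  show "finite (PiE (UNIV :: 3 set) (\<lambda>_. {0..<4::int} \<times> {0..<4::int}))"
    by (intro finite_PiE) auto
  fix P assume "P \<in> {form_polytope d A | d A. d > 0 \<and> squarefree d \<and> perfect_form d A}"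
  then obtain d A where "P = form_polytope d A"
    and d: "d > 0" "squarefree d" and A: "A \<in> positive_definite_forms"
    by (auto simp: perfect_form_def)
  then show "\<exists>S h. P = convex hull S \<and> inj_on h S \<and>
      h ` S \<subseteq> PiE (UNIV :: 3 set) (\<lambda>_. {0..<4::int} \<times> {0..<4::int})"
    using inj_on_minimal_rank_one[OF d A] unfolding form_polytope_def by metis
qed

end
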